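(* Let $n\in\mathbb N$. Let $L_1,\dots,L_n:[0,1]\to[0,\infty)$ be continuous functions with $L_j(0)=0$ and $L_j(t)>0$ for $t\in(0,1)$, such that $\log L_j$ is concave on $(0,1)$. Suppose that for some $c>0$ $$\frac{d}{dt}\log\frac{L_j(t)}{L_j(1-t)}\ge c\quad\text{for } j=1,\dots,n\text{ and almost every }t\in(0,1).$$ Let $w:[0,1]\to[0,\infty)$ be an upper semicontinuous function with at least $n+1$ points of $(0,1)$ where $w\ne0$. Then for every $\alpha_0,\dots,\alpha_n>0$ there exist a unique system $0<y_1<\dots<y_n<1$ and a unique $C>0$ with the following property. For the function $$G(t):=C\,w(t)\prod_{k=1}^nL_k(|t-y_k|),$$ there exist points $z_0,\dots,z_n$ with $$0\le z_0<y_1<z_1<y_2<\dots<z_{n-1}<y_n<z_n\le1,$$ such that $G(z_j)=\alpha_j$ for $j=0,\dots,n$ and $z_j$ is a maximum point of $G$ on $[y_j,y_{j+1}]$ for each $j=0,\dots,n$, where $y_0:=0$ and $y_{n+1}:=1$. *)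

theory Defs
  imports "HOL-Analysis.Analysis"
begin

definition usc_on :: "real set \<Rightarrow> (real \<Rightarrow> real) \<Rightarrow> bool" where
  "usc_on S f \<longleftrightarrow> (\<forall>t\<in>S. \<forall>a. f t < a \<longrightarrow>
      (\<exists>d>0. \<forall>s\<in>S. \<bar>s - t\<bar> < d \<longrightarrow> f s < a))"

definition ext_nodes :: "nat \<Rightarrow> (nat \<Rightarrow> real) \<Rightarrow> nat \<Rightarrow> real" where
  "ext_nodes n y k = (if k = 0 then 0 else if k = n + 1 then 1 else y k)"

definition good_system ::
  "nat \<Rightarrow> (nat \<Rightarrow> real \<Rightarrow> real) \<Rightarrow> (real \<Rightarrow> real) \<Rightarrow> (nat \<Rightarrow> real)
     \<Rightarrow> (nat \<Rightarrow> real) \<Rightarrow> real \<Rightarrow> bool" where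
  "good_system n L w \<alpha> y C \<longleftrightarrow>
     C > 0 \<and> (\<forall>k\<le>n. ext_nodes n y k < ext_nodes n y (k + 1)) \<and>
     (let G = (\<lambda>t. C * w t * (\<Prod>k\<in>{1..n}. L k \<bar>t - y k\<bar>)) in
      \<exists>z :: nat \<Rightarrow> real. \<forall>j\<le>n.
        (j = 0 \<longrightarrow> 0 \<le> z j) \<and> (0 < j \<longrightarrow> ext_nodes n y j < z j) \<and>
        (j < n \<longrightarrow> z j < ext_nodes n y (j + 1)) \<and> (j = n \<longrightarrow> z j \<le> 1) \<and>
        G (z j) = \<alpha> j \<and>
        (\<forall>t\<in>{ext_nodes n y j .. ext_nodes n y (j + 1)}. G t \<le> G (z j)))"

end

theory Submission
  imports Defs
begin

text \<open>
  Let \<open>M j y\<close> be the maximum over the \<open>j\<close>-th interval of the product without the factor \<open>C\<close>;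
  the task is to make \<open>M j y / \<alpha> j\<close> independent of \<open>j\<close>.
  Evaluating at maximum points and using log-concavity factor by factor shows that
  \<open>M j y / M (j - 1) y\<close> does not decrease when nodes other than the \<open>j\<close>-th move to the right.
  Hence the closed set of systems with \<open>M 0 y / \<alpha> 0 \<le> \<dots> \<le> M n y / \<alpha> n\<close>, degenerate ones included,
  is stable under componentwise maxima and has a greatest element. There all quotients agree, since
  otherwise a node could be moved further to the right, and they are not all 0, since \<open>w\<close> is nonzero
  at more than \<open>n\<close> points of the open interval.

  The derivative condition enters only in the uniqueness: it makes \<open>M n y / M 0 y\<close> strictly decreasing in
  every node. If \<open>x\<close> and \<open>y\<close> are solutions, their componentwise maximum \<open>u\<close> satisfies
  \<open>M 0 u / \<alpha> 0 \<le> M n u / \<alpha> n\<close>, so \<open>u\<close> coincides with both.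
\<close>

section \<open>Concave functions and monotonicity from an almost everywhere derivative\<close>

text \<open>Both \<open>q\<close> and \<open>r\<close> lie between \<open>p\<close> and
  \<open>s\<close> and are convex combinations of them with interchanged weights, so the two
  concavity inequalities add up to the claim.\<close>

lemma concave_on_four_points:
  fixes f :: "real \<Rightarrow> real"
  assumes f: "concave_on I f" and "p \<in> I" "s \<in> I" "p \<le> q" "p \<le> r" "q + r = p + s"
  shows "f p + f s \<le> f q + f r"
proof (cases "p = s")
  case True
  then have "q = p" "r = p" using assms by auto
  then show ?thesis using True by simp
next
  case False
  then have "p < s" using assms by auto
  define t where "t = (q - p) / (s - p)"
  have t: "0 \<le> t" "t \<le> 1" using assms \<open>p < s\<close> by (auto simp: t_def divide_simps)
  have "t * (s - p) = q - p" using \<open>p < s\<close> by (simp add: t_def)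
  then have q: "q = (1 - t) * p + t * s" and r: "r = (1 - t) * s + t * p"
    using \<open>q + r = p + s\<close> by (auto simp: algebra_simps)
  have "f q \<ge> (1 - t) * f p + t * f s" "f r \<ge> (1 - t) * f s + t * f p"
    using concave_onD[OF f t \<open>p \<in> I\<close> \<open>s \<in> I\<close>] concave_onD[OF f t \<open>s \<in> I\<close> \<open>p \<in> I\<close>]
    by (auto simp: q r)
  then show ?thesis by (simp add: algebra_simps)
qed

text \<open>Chords from \<open>x\<close> to \<open>x + d\<close> and \<open>x - d\<close> bound
  \<open>f\<close> from below, and \<open>f (x + h) + f (x - h) \<le> 2 * f x\<close> turns the
  lower bound on one side into an upper bound on the other. A Lipschitz bound of this kind makes
  images of null sets null.\<close>

lemma concave_on_pointwise_Lipschitz: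
  fixes f :: "real \<Rightarrow> real"
  assumes f: "concave_on I f" and "open I" "x \<in> I"
  shows "\<exists>d>0. \<exists>B. \<forall>y. \<bar>y - x\<bar> < d \<longrightarrow> \<bar>f y - f x\<bar> \<le> B * \<bar>y - x\<bar>"
proof -
  obtain d where d: "d > 0" "cball x d \<subseteq> I"
    using assms open_contains_cball by meson
  have I: "y \<in> I" if "\<bar>y - x\<bar> \<le> d" for y
    using d that by (auto simp: subset_iff dist_real_def abs_minus_commute)
  define A where "A = f (x + d) - f x"
  define A' where "A' = f x - f (x - d)"
  have *: "\<bar>f y - f x\<bar> \<le> ((\<bar>A\<bar> + \<bar>A'\<bar>) / d) * \<bar>y - x\<bar>" if y: "\<bar>y - x\<bar> < d" for y
  proof -
    define t where "t = \<bar>y - x\<bar> / d"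
    have t: "0 \<le> t" "t \<le> 1" and td: "t * d = \<bar>y - x\<bar>" using y d by (auto simp: t_def)
    have chord: "(1 - t) * f x + t * f (x + e) \<le> f (x + t * e)" if "\<bar>e\<bar> \<le> d" for e
      using concave_onD[OF f t, of x "x + e"] I[of "x + e"] \<open>x \<in> I\<close> that
      by (simp add: algebra_simps)
    have mid: "f (x + t * d) + f (x - t * d) \<le> 2 * f x"
    proof -
      have "t * d \<le> d" "0 \<le> t * d" using t d y td by auto
      then show ?thesis
        using concave_on_four_points[OF f I I, of "x - t * d" "x + t * d" x x]
        by (simp add: \<open>0 \<le> t * d\<close>)
    qed
    have up: "t * A \<le> f (x + t * d) - f x" and lo: "f x - f (x - t * d) \<le> t * A'"
      using chord[of d] chord[of "-d"] d by (auto simp: A_def A'_def algebra_simps)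
    have "\<bar>t * A\<bar> \<le> t * (\<bar>A\<bar> + \<bar>A'\<bar>)" "\<bar>t * A'\<bar> \<le> t * (\<bar>A\<bar> + \<bar>A'\<bar>)"
      using t by (auto simp: abs_mult intro!: mult_left_mono)
    moreover have "y = x + t * d \<or> y = x - t * d" using td by auto
    ultimately have "\<bar>f y - f x\<bar> \<le> t * (\<bar>A\<bar> + \<bar>A'\<bar>)"
      using up lo mid by (elim disjE) auto
    then show ?thesis by (simp add: t_def mult.commute)
  qed
  then show ?thesis using d(1) by blast
qed

text \<open>
  Almost every level between \<open>f b\<close> and \<open>f a\<close> avoids the null image of the exceptional set, and at
  the last point where such a level is taken the derivative cannot be positive.
\<close>
lemma AE_pos_derivative_imp_le:
  fixes f :: "real \<Rightarrow> real"
  assumes "a \<le> b" and cont: "continuous_on {a..b} f"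
    and lip: "\<And>x. x \<in> {a<..<b} \<Longrightarrow>
       \<exists>d>0. \<exists>B. \<forall>y. \<bar>y - x\<bar> < d \<longrightarrow> \<bar>f y - f x\<bar> \<le> B * \<bar>y - x\<bar>"
    and ae: "AE t in lborel. t \<in> {a<..<b} \<longrightarrow> (\<exists>D>0. (f has_real_derivative D) (at t))"
  shows "f a \<le> f b"
proof (rule ccontr)
  assume "\<not> f a \<le> f b"
  then have less: "f b < f a" by simp
  define N where "N = {t\<in>{a<..<b}. \<not> (\<exists>D>0. (f has_real_derivative D) (at t))}"
  \<comment> \<open>Nothing is known about the measurability of \<open>N\<close>; in the completed
    measure every subset of a null set is null.\<close>
  have "AE t in lebesgue. t \<notin> N"
    using AE_completion[OF ae] by (rule eventually_mono) (auto simp: N_def)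
  then have "negligible N"
    by (auto simp: eventually_ae_filter negligible_iff_null_sets intro: completion.complete2)
  moreover have "\<exists>T B. open T \<and> x \<in> T \<and> (\<forall>y\<in>N \<inter> T. norm (f y - f x) \<le> B * norm (y - x))"
    if x: "x \<in> N" for x
  proof -
    obtain d B where "d > 0" and B: "\<And>y. \<bar>y - x\<bar> < d \<Longrightarrow> \<bar>f y - f x\<bar> \<le> B * \<bar>y - x\<bar>"
      using lip[of x] x unfolding N_def by blast
    then show ?thesis
      by (intro exI[of _ "ball x d"] exI[of _ B]) (auto simp: dist_real_def abs_minus_commute)
  qed
  ultimately have "negligible (f ` N)"
    by (intro negligible_locally_Lipschitz_image) auto
  moreover have "\<not> negligible {f b<..<f a}"
    using less open_not_negligible[of "{f b<..<f a}"] by auto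
  ultimately obtain v where v: "f b < v" "v < f a" "v \<notin> f ` N"
    using negligible_subset[of "f ` N" "{f b<..<f a}"]
    by (metis greaterThanLessThan_iff subsetI)
  define S where "S = {a..b} \<inter> f -` {v}"
  have "compact S"
    unfolding S_def using continuous_closed_preimage[OF cont, of "{v}"]
    by (metis closed_atLeastAtMost closed_singleton compact_Icc compact_Int_closed
        Int_absorb2 Int_commute Int_left_absorb)
  moreover have "S \<noteq> {}"
    using IVT2'[of f b v a] v \<open>a \<le> b\<close> cont by (auto simp: S_def)
  ultimately obtain s where s: "s \<in> S" "\<And>t. t \<in> S \<Longrightarrow> t \<le> s"
    using compact_attains_sup by metis
  have fs: "f s = v" and "s \<in> {a..b}" using s(1) by (auto simp: S_def)
  then have "s \<in> {a<..<b}" using v by (auto simp: less_le)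
  with fs v(3) obtain D where "D > 0" "(f has_real_derivative D) (at s)"
    by (auto simp: N_def)
  then obtain d where d: "d > 0" "\<And>h. 0 < h \<Longrightarrow> h < d \<Longrightarrow> f s < f (s + h)"
    using DERIV_pos_inc_right by blast
  \<comment> \<open>A positive derivative puts \<open>f (s + h)\<close> above \<open>v\<close>,
    while \<open>f b < v\<close>; the intermediate value theorem then gives a point of
    \<open>S\<close> beyond its last one.\<close>
  define h where "h = min (d / 2) (b - s)"
  have h: "0 < h" "h < d" "s + h \<le> b" using d(1) \<open>s \<in> {a<..<b}\<close> by (auto simp: h_def)
  then have "v \<le> f (s + h)" using d(2) fs by force
  moreover have "continuous_on {s + h..b} f"
    using cont by (rule continuous_on_subset) (use h \<open>s \<in> {a<..<b}\<close> in auto)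
  ultimately obtain t where "s + h \<le> t" "t \<le> b" "f t = v"
    using IVT2'[of f b v "s + h"] v h by auto
  then have "t \<in> S" using h \<open>s \<in> {a<..<b}\<close> by (auto simp: S_def)
  then show False using s(2)[of t] \<open>s + h \<le> t\<close> h by auto
qed

section \<open>Product inequalities for log-concave functions\<close>

text \<open>Logarithms are available only in the open interval, whereas the points may reach 1. For
  \<open>p > 0\<close>, scaling all four points by \<open>x < 1\<close> moves them inside, and
  continuity lets \<open>x\<close> tend to 1. For \<open>p = 0\<close> the left side
  vanishes.\<close>

lemma log_concave_four_points:
  fixes f :: "real \<Rightarrow> real"
  assumes cont: "continuous_on {0..1} f"
    and nonneg: "\<And>t. t \<in> {0..1} \<Longrightarrow> f t \<ge> 0"
    and zero: "f 0 = 0"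
    and pos: "\<And>t. t \<in> {0<..<1} \<Longrightarrow> f t > 0"
    and conc: "concave_on {0<..<1} (\<lambda>t. ln (f t))"
    and "0 \<le> p" "p \<le> q" "p \<le> r" "s \<le> 1" "q + r = p + s"
  shows "f p * f s \<le> f q * f r"
proof (cases "p = 0")
  case True
  then show ?thesis using assms by auto
next
  case False
  have scaled: "f (p * x) * f (s * x) \<le> f (q * x) * f (r * x)" if x: "x \<in> {0<..<1}" for x
  proof -
    have in01: "y * x \<in> {0<..<1}" if "0 < y" "y \<le> 1" for y
      using x that mult_le_one[of y x] mult_less_le_imp_less[of x 1 y 1] by (auto simp: mult.commute)
    have mem: "p * x \<in> {0<..<1}" "q * x \<in> {0<..<1}" "r * x \<in> {0<..<1}" "s * x \<in> {0<..<1}"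
      using assms False by (auto intro!: in01 simp del: greaterThanLessThan_iff)
    have "ln (f (p * x)) + ln (f (s * x)) \<le> ln (f (q * x)) + ln (f (r * x))"
      using assms x mem by (intro concave_on_four_points[OF conc]) (auto simp flip: distrib_right)
    then have "ln (f (p * x) * f (s * x)) \<le> ln (f (q * x) * f (r * x))"
      using pos mem by (simp add: ln_mult less_imp_neq[symmetric])
    then show ?thesis using pos mem by simp
  qed
  have lim: "((\<lambda>x. f (y * x)) \<longlongrightarrow> f y) (at_left 1)" if "y \<in> {0..1}" for y
  proof -
    have "continuous_on {0..1} (\<lambda>x. f (y * x))"
      using that by (intro continuous_on_compose2[OF cont] continuous_intros) (auto simp: mult_le_one)
    then have "((\<lambda>x. f (y * x)) \<longlongrightarrow> f (y * 1)) (at 1 within {0..1})"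
      unfolding continuous_on by (rule bspec) simp
    then show ?thesis by (simp add: at_within_Icc_at_left)
  qed
  have "\<forall>\<^sub>F x in at_left (1::real). x \<in> {0<..<1}"
    using eventually_at_left_real[of 0 1] by simp
  then show ?thesis
    using assms by (intro tendsto_le[OF _ tendsto_mult[OF lim lim] tendsto_mult[OF lim lim]])
      (auto elim!: eventually_mono intro: scaled)
qed

text \<open>The logarithm of the quotient is a difference of two concave functions and therefore
  pointwise Lipschitz, so its derivative almost everywhere controls its increments.\<close>

lemma log_concave_ratio_strict_mono:
  fixes f :: "real \<Rightarrow> real"
  assumes cont: "continuous_on {0..1} f"
    and pos: "\<And>t. t \<in> {0<..<1} \<Longrightarrow> f t > 0"
    and conc: "concave_on {0<..<1} (\<lambda>t. ln (f t))"
    and "c > 0"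
    and deriv: "AE t in lborel. t \<in> {0<..<1} \<longrightarrow>
          (\<exists>D. ((\<lambda>s. ln (f s / f (1 - s))) has_real_derivative D) (at t) \<and> D \<ge> c)"
    and ab: "0 < a" "a < b" "b < 1"
  shows "ln (f a / f (1 - a)) < ln (f b / f (1 - b))"
proof -
  define R where "R t = ln (f t / f (1 - t))" for t
  have R: "R t = ln (f t) - ln (f (1 - t))" if "t \<in> {0<..<1}" for t
    using pos[of t] pos[of "1 - t"] that by (simp add: R_def ln_div)
  have cont': "continuous_on {0<..<1} f" using cont by (rule continuous_on_subset) auto
  \<comment> \<open>After subtracting slope \<open>c / 2\<close> the derivative is still at least
    \<open>c / 2\<close>, hence positive; the subtracted linear term supplies the
    strictness.\<close>
  have "R a - c / 2 * a \<le> R b - c / 2 * b"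
  proof (rule AE_pos_derivative_imp_le[where f = "\<lambda>t. R t - c / 2 * t"])
    have "continuous_on {a..b} (\<lambda>t. ln (f t) - ln (f (1 - t)) - c / 2 * t)"
      using ab pos by (intro continuous_intros continuous_on_compose2[OF cont'])
        (auto simp: less_imp_neq[symmetric])
    then show "continuous_on {a..b} (\<lambda>t. R t - c / 2 * t)"
      by (rule continuous_on_eq) (use R ab in auto)
  next
    fix x assume x: "x \<in> {a<..<b}"
    then have x01: "x \<in> {0<..<1}" using ab by auto
    obtain d1 B1 where 1: "d1 > 0" "\<And>y. \<bar>y - x\<bar> < d1 \<Longrightarrow> \<bar>ln (f y) - ln (f x)\<bar> \<le> B1 * \<bar>y - x\<bar>"
      using concave_on_pointwise_Lipschitz[OF conc _ x01] by auto
    have "1 - x \<in> {0<..<1}" using x01 by auto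
    then obtain d2 B2 where 2: "d2 > 0"
      "\<And>y. \<bar>y - (1 - x)\<bar> < d2 \<Longrightarrow> \<bar>ln (f y) - ln (f (1 - x))\<bar> \<le> B2 * \<bar>y - (1 - x)\<bar>"
      using concave_on_pointwise_Lipschitz[OF conc, of "1 - x"] by auto
    define d where "d = Min {d1, d2, x, 1 - x}"
    have "d > 0" using 1 2 x01 by (auto simp: d_def)
    moreover have "\<bar>(R y - c / 2 * y) - (R x - c / 2 * x)\<bar> \<le> (B1 + B2 + c / 2) * \<bar>y - x\<bar>"
      if y: "\<bar>y - x\<bar> < d" for y
    proof -
      have y': "\<bar>y - x\<bar> < d1" "\<bar>y - x\<bar> < d2" "\<bar>y - x\<bar> < x" "\<bar>y - x\<bar> < 1 - x"
        using y by (auto simp: d_def)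
      then have "y \<in> {0<..<1}" by auto
      have "\<bar>ln (f (1 - y)) - ln (f (1 - x))\<bar> \<le> B2 * \<bar>y - x\<bar>"
        using 2(2)[of "1 - y"] y' by (simp add: abs_minus_commute)
      moreover have "\<bar>c / 2 * y - c / 2 * x\<bar> = c / 2 * \<bar>y - x\<bar>"
        using abs_mult[of "c / 2" "y - x"] \<open>c > 0\<close> by (simp add: right_diff_distrib)
      ultimately show ?thesis
        using 1(2)[OF y'(1)] R[OF x01] R[OF \<open>y \<in> {0<..<1}\<close>] unfolding distrib_right by linarith
    qed
    ultimately show "\<exists>d>0. \<exists>B. \<forall>y. \<bar>y - x\<bar> < d \<longrightarrow>
        \<bar>(R y - c / 2 * y) - (R x - c / 2 * x)\<bar> \<le> B * \<bar>y - x\<bar>" by blast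
  next
    show "AE t in lborel. t \<in> {a<..<b} \<longrightarrow>
        (\<exists>D>0. ((\<lambda>t. R t - c / 2 * t) has_real_derivative D) (at t))"
      using deriv
    proof (rule eventually_mono, intro impI)
      fix t assume "t \<in> {0<..<1} \<longrightarrow>
          (\<exists>D. ((\<lambda>s. ln (f s / f (1 - s))) has_real_derivative D) (at t) \<and> D \<ge> c)"
        and "t \<in> {a<..<b}"
      then obtain D where "(R has_real_derivative D) (at t)" "D \<ge> c"
        using ab unfolding R_def[abs_def] by auto
      then show "\<exists>D>0. ((\<lambda>t. R t - c / 2 * t) has_real_derivative D) (at t)"
        using \<open>c > 0\<close> by (intro exI[of _ "D - c / 2"]) (auto intro!: derivative_eq_intros)
    qed
  qed (use ab in auto)
  moreover have "c / 2 * a < c / 2 * b" using ab \<open>c > 0\<close> by simp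
  ultimately show ?thesis unfolding R_def by linarith
qed

text \<open>Both arguments move in the same direction, so concavity alone does not decide. The
  reflected points \<open>1 - a\<close> and \<open>1 - a - h\<close> mediate: a weak four-point
  inequality pairs them with \<open>b\<close> and \<open>b + h\<close>, the strict quotient
  inequality pairs them with \<open>a\<close> and \<open>a + h\<close>, and their values
  cancel.\<close>

lemma log_concave_strict_product:
  fixes f :: "real \<Rightarrow> real"
  assumes cont: "continuous_on {0..1} f"
    and nonneg: "\<And>t. t \<in> {0..1} \<Longrightarrow> f t \<ge> 0"
    and zero: "f 0 = 0"
    and pos: "\<And>t. t \<in> {0<..<1} \<Longrightarrow> f t > 0"
    and conc: "concave_on {0<..<1} (\<lambda>t. ln (f t))"
    and "c > 0"
    and deriv: "AE t in lborel. t \<in> {0<..<1} \<longrightarrow>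
          (\<exists>D. ((\<lambda>s. ln (f s / f (1 - s))) has_real_derivative D) (at t) \<and> D \<ge> c)"
    and ab: "0 < a" "0 < b" "0 < h" "a + b + h \<le> 1"
  shows "f a * f b < f (a + h) * f (b + h)"
proof -
  have 1: "f b * f (1 - a) \<le> f (b + h) * f (1 - a - h)"
    by (rule log_concave_four_points[OF cont nonneg zero pos conc]) (use ab in auto)
  have p: "f a > 0" "f b > 0" "f (a + h) > 0" "f (b + h) > 0" "f (1 - a) > 0" "f (1 - a - h) > 0"
    using ab by (auto intro!: pos)
  have "ln (f a / f (1 - a)) < ln (f (a + h) / f (1 - (a + h)))"
    by (rule log_concave_ratio_strict_mono[OF cont pos conc \<open>c > 0\<close> deriv]) (use ab in auto)
  then have "f a / f (1 - a) < f (a + h) / f (1 - a - h)"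
    using p by (simp add: diff_diff_eq)
  then have 2: "f a * f (1 - a - h) < f (a + h) * f (1 - a)"
    using p by (simp add: divide_simps split: if_splits)
  have "(f a * f (1 - a - h)) * (f b * f (1 - a)) < (f (a + h) * f (1 - a)) * (f b * f (1 - a))"
    using 2 p by simp
  also have "\<dots> \<le> (f (a + h) * f (1 - a)) * (f (b + h) * f (1 - a - h))"
    using 1 p by simp
  finally have "(f a * f b) * (f (1 - a) * f (1 - a - h))
      < (f (a + h) * f (b + h)) * (f (1 - a) * f (1 - a - h))"
    by (simp add: mult_ac)
  then show ?thesis using p by (simp add: mult_less_cancel_right zero_less_mult_iff)
qed

section \<open>Upper semicontinuous functions and a strict product comparison\<close>

text \<open>If no maximum existed, each \<open>z\<close> would have a neighbourhood on which
  \<open>f\<close> stays below a value \<open>f (b z)\<close>. For a finite subcover, the largest of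
  these values is taken at a point that is itself covered, which is impossible.\<close>

lemma usc_on_attains_sup:
  assumes "compact S" "S \<noteq> {}" and usc: "usc_on S f"
  shows "\<exists>z\<in>S. \<forall>t\<in>S. f t \<le> f z"
proof (rule ccontr)
  assume "\<not> ?thesis"
  then have "\<forall>z\<in>S. \<exists>t\<in>S. f z < f t" by (auto simp: not_le)
  then obtain b where b: "\<And>z. z \<in> S \<Longrightarrow> b z \<in> S \<and> f z < f (b z)" by metis
  have "\<forall>z\<in>S. \<exists>d>0. \<forall>s\<in>S. \<bar>s - z\<bar> < d \<longrightarrow> f s < f (b z)"
    using usc b unfolding usc_on_def by blast
  then obtain d where d: "\<And>z. z \<in> S \<Longrightarrow> d z > 0"
    "\<And>z s. z \<in> S \<Longrightarrow> s \<in> S \<Longrightarrow> \<bar>s - z\<bar> < d z \<Longrightarrow> f s < f (b z)" by metis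
  obtain Z where Z: "Z \<subseteq> S" "finite Z" "S \<subseteq> (\<Union>z\<in>Z. ball z (d z))"
    using \<open>compact S\<close>
  proof (rule compactE_image)
    show "S \<subseteq> (\<Union>z\<in>S. ball z (d z))" using d(1) by force
  qed auto
  then have "Z \<noteq> {}" using \<open>S \<noteq> {}\<close> by auto
  then have "Max ((f \<circ> b) ` Z) \<in> (f \<circ> b) ` Z" using \<open>finite Z\<close> by (intro Max_in) auto
  then obtain z0 where "z0 \<in> Z" "f (b z0) = Max ((f \<circ> b) ` Z)" by auto
  then have z0: "z0 \<in> Z" "\<And>z. z \<in> Z \<Longrightarrow> f (b z) \<le> f (b z0)"
    using \<open>finite Z\<close> by (auto intro!: Max_ge)
  then have "b z0 \<in> S" using b Z by auto
  then obtain z where "z \<in> Z" "\<bar>b z0 - z\<bar> < d z"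
    using Z(3) by (auto simp: dist_real_def abs_minus_commute)
  then have "f (b z0) < f (b z)" using d(2) Z \<open>b z0 \<in> S\<close> by auto
  then show False using z0(2)[OF \<open>z \<in> Z\<close>] by simp
qed

text \<open>Nonnegativity makes multiplication monotone, so it suffices to find \<open>e > 0\<close>
  with \<open>(f t + e) * (g t + e) < a\<close>.\<close>

lemma usc_on_mult_continuous:
  assumes usc: "usc_on S f" and f: "\<And>t. t \<in> S \<Longrightarrow> f t \<ge> 0"
    and cont: "continuous_on S g" and g: "\<And>t. t \<in> S \<Longrightarrow> g t \<ge> 0"
  shows "usc_on S (\<lambda>t. f t * g t)"
  unfolding usc_on_def
proof (intro ballI allI impI)
  fix t a assume t: "t \<in> S" and a: "f t * g t < a"
  have "((\<lambda>e. (f t + e) * (g t + e)) \<longlongrightarrow> (f t + 0) * (g t + 0)) (at_right 0)"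
    by (intro tendsto_intros)
  then have "\<forall>\<^sub>F e in at_right 0. (f t + e) * (g t + e) < a"
    using a by (auto dest: order_tendstoD(2))
  moreover have "\<forall>\<^sub>F e in at_right (0::real). e > 0"
    by (simp add: eventually_at_right_less)
  ultimately have "\<exists>e. (f t + e) * (g t + e) < a \<and> e > 0"
    by (intro eventually_happens'[OF _ eventually_conj]) auto
  then obtain e where e: "e > 0" "(f t + e) * (g t + e) < a" by auto
  obtain d1 where d1: "d1 > 0" "\<And>s. s \<in> S \<Longrightarrow> \<bar>s - t\<bar> < d1 \<Longrightarrow> f s < f t + e"
    using usc t e unfolding usc_on_def by (metis less_add_same_cancel1)
  obtain d2 where d2: "d2 > 0" "\<And>s. s \<in> S \<Longrightarrow> \<bar>s - t\<bar> < d2 \<Longrightarrow> \<bar>g s - g t\<bar> < e"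
    using cont t e unfolding continuous_on_iff dist_real_def by metis
  have "f s * g s < a" if "s \<in> S" "\<bar>s - t\<bar> < min d1 d2" for s
  proof -
    have "f s \<le> f t + e" "g s \<le> g t + e" using d1(2)[of s] d2(2)[of s] that by auto
    then have "f s * g s \<le> (f t + e) * (g t + e)"
      using f g that t e by (intro mult_mono) (auto simp: add_nonneg_nonneg)
    then show ?thesis using e by simp
  qed
  then show "\<exists>d>0. \<forall>s\<in>S. \<bar>s - t\<bar> < d \<longrightarrow> f s * g s < a"
    using d1 d2 by (intro exI[of _ "min d1 d2"]) auto
qed

lemma prod_less_prod:
  fixes f g :: "'a \<Rightarrow> real"
  assumes "finite A" and le: "\<And>i. i \<in> A \<Longrightarrow> 0 < f i \<and> f i \<le> g i" and "k \<in> A" "f k < g k"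
  shows "prod f A < prod g A"
proof -
  have "f k * prod f (A - {k}) < g k * prod g (A - {k})"
    using assms by (intro mult_less_le_imp_less prod_mono prod_pos) (auto simp: less_imp_le)
  then show ?thesis using assms by (simp add: prod.remove)
qed

section \<open>Systems of nodes and the maxima over their intervals\<close>

locale log_concave_translates =
  fixes n :: nat and L :: "nat \<Rightarrow> real \<Rightarrow> real" and w :: "real \<Rightarrow> real"
  assumes L_cont: "\<And>j. j \<in> {1..n} \<Longrightarrow> continuous_on {0..1} (L j)"
    and L_nonneg: "\<And>j t. j \<in> {1..n} \<Longrightarrow> t \<in> {0..1} \<Longrightarrow> L j t \<ge> 0"
    and L_zero: "\<And>j. j \<in> {1..n} \<Longrightarrow> L j 0 = 0"
    and L_pos: "\<And>j t. j \<in> {1..n} \<Longrightarrow> t \<in> {0<..<1} \<Longrightarrow> L j t > 0"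
    and L_logconc: "\<And>j. j \<in> {1..n} \<Longrightarrow> concave_on {0<..<1} (\<lambda>t. ln (L j t))"
    and w_usc: "usc_on {0..1} w"
    and w_nonneg: "\<And>t. t \<in> {0..1} \<Longrightarrow> w t \<ge> 0"
    and w_points: "\<exists>S. S \<subseteq> {t \<in> {0<..<1}. w t \<noteq> 0} \<and> finite S \<and> card S = n + 1"
begin

text \<open>The inequalities are weak so that limits and componentwise maxima of systems are again
  systems.\<close>

definition nodes :: "(nat \<Rightarrow> real) \<Rightarrow> bool" where
  "nodes y \<longleftrightarrow> (\<forall>k\<in>{1..n}. 0 \<le> y k \<and> y k \<le> 1) \<and> mono_on {1..n} y"

definition side :: "nat \<Rightarrow> nat \<Rightarrow> (nat \<Rightarrow> real) \<Rightarrow> real \<Rightarrow> real" where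
  "side j k y t = max 0 (if k \<le> j then t - y k else y k - t)"

text \<open>
  Since every \<open>L k\<close> vanishes at 0, clamping the distances at 0 makes the product vanish outside
  the \<open>j\<close>-th interval. Its maximum there thus becomes a supremum over the fixed set \<open>{0..1}\<close>,
  which is continuous in \<open>y\<close> up to and including degenerate nodes.
\<close>
definition Phi :: "nat \<Rightarrow> (nat \<Rightarrow> real) \<Rightarrow> real \<Rightarrow> real" where
  "Phi j y t = w t * (\<Prod>k\<in>{1..n}. L k (side j k y t))"

definition M :: "nat \<Rightarrow> (nat \<Rightarrow> real) \<Rightarrow> real" where
  "M j y = (SUP t\<in>{0..1}. Phi j y t)"

lemma nodes_bounds: "nodes y \<Longrightarrow> k \<in> {1..n} \<Longrightarrow> 0 \<le> y k \<and> y k \<le> 1"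
  by (simp add: nodes_def)

lemma nodes_mono: "nodes y \<Longrightarrow> i \<in> {1..n} \<Longrightarrow> k \<in> {1..n} \<Longrightarrow> i \<le> k \<Longrightarrow> y i \<le> y k"
  unfolding nodes_def by (blast dest: mono_onD)

lemma nodesI:
  assumes "\<And>k. k \<in> {1..n} \<Longrightarrow> 0 \<le> y k" "\<And>k. k \<in> {1..n} \<Longrightarrow> y k \<le> 1"
    and "\<And>i k. i \<in> {1..n} \<Longrightarrow> k \<in> {1..n} \<Longrightarrow> i \<le> k \<Longrightarrow> y i \<le> y k"
  shows "nodes y"
  using assms unfolding nodes_def by (auto intro!: mono_onI)

lemma side_mem:
  "nodes y \<Longrightarrow> k \<in> {1..n} \<Longrightarrow> t \<in> {0..1} \<Longrightarrow> side j k y t \<in> {0..1}"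
  unfolding nodes_def side_def by (drule conjunct1, drule (1) bspec) (auto simp: max_def)

lemma L_side_nonneg:
  "nodes y \<Longrightarrow> k \<in> {1..n} \<Longrightarrow> t \<in> {0..1} \<Longrightarrow> L k (side j k y t) \<ge> 0"
  by (intro L_nonneg side_mem)

lemma Phi_nonneg: "nodes y \<Longrightarrow> t \<in> {0..1} \<Longrightarrow> Phi j y t \<ge> 0"
  unfolding Phi_def by (intro mult_nonneg_nonneg prod_nonneg w_nonneg L_side_nonneg) auto

lemma continuous_on_L_side:
  assumes "nodes y" "k \<in> {1..n}"
  shows "continuous_on {0..1} (\<lambda>t. L k (side j k y t))"
proof (rule continuous_on_compose2[OF L_cont])
  show "continuous_on {0..1} (side j k y)"
    unfolding side_def[abs_def] by (cases "k \<le> j") (auto intro!: continuous_intros)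
qed (use assms side_mem in auto)

lemma continuous_on_prod_L_side:
  assumes "nodes y" "K \<subseteq> {1..n}"
  shows "continuous_on {0..1} (\<lambda>t. \<Prod>k\<in>K. L k (side j k y t))"
  using assms by (intro continuous_on_prod continuous_on_L_side) auto

lemma M_attained:
  assumes "nodes y"
  obtains z where "z \<in> {0..1}" "M j y = Phi j y z" "\<And>t. t \<in> {0..1} \<Longrightarrow> Phi j y t \<le> M j y"
proof -
  have "usc_on {0..1} (Phi j y)"
    unfolding Phi_def[abs_def] using assms
    by (intro usc_on_mult_continuous w_usc w_nonneg continuous_on_prod_L_side prod_nonneg
        L_side_nonneg) auto
  then obtain z where z: "z \<in> {0..1}" "\<And>t. t \<in> {0..1} \<Longrightarrow> Phi j y t \<le> Phi j y z"
    using usc_on_attains_sup[of "{0..1}" "Phi j y"] by auto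
  then have "M j y = Phi j y z"
    unfolding M_def by (intro cSup_eq_maximum) auto
  with z show ?thesis using that by metis
qed

lemma M_upper: "nodes y \<Longrightarrow> t \<in> {0..1} \<Longrightarrow> Phi j y t \<le> M j y"
  using M_attained by metis

lemma M_nonneg: "nodes y \<Longrightarrow> M j y \<ge> 0"
  using M_upper[of y 0 j] Phi_nonneg[of y 0 j] by simp

text \<open>A positive product has no vanishing factor, and \<open>L k\<close> vanishes at 0, so no
  distance has been clamped to 0. This is how strict order is recovered from the weak order in
  \<open>nodes\<close>.\<close>

lemma Phi_posD:
  assumes "nodes y" "z \<in> {0..1}" "Phi j y z > 0"
  shows "w z > 0" "\<And>k. k \<in> {1..n} \<Longrightarrow> L k (side j k y z) > 0"
    "\<And>k. k \<in> {1..n} \<Longrightarrow> k \<le> j \<Longrightarrow> y k < z" "\<And>k. k \<in> {1..n} \<Longrightarrow> j < k \<Longrightarrow> z < y k"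
proof -
  have nz: "w z \<noteq> 0" "\<And>k. k \<in> {1..n} \<Longrightarrow> L k (side j k y z) \<noteq> 0"
    using assms(3) prod_zero[of "{1..n}" "\<lambda>k. L k (side j k y z)"]
    unfolding Phi_def by (fastforce, metis finite_atLeastAtMost less_irrefl mult_zero_right)
  show "w z > 0" using nz(1) w_nonneg[OF assms(2)] by simp
  show "L k (side j k y z) > 0" if "k \<in> {1..n}" for k
    using nz(2)[OF that] L_side_nonneg[OF assms(1) that assms(2), of j] by simp
  have "side j k y z \<noteq> 0" if "k \<in> {1..n}" for k
    using nz(2)[OF that] L_zero[OF that] by metis
  then have "side j k y z > 0" if "k \<in> {1..n}" for k
    using side_mem[OF assms(1) that assms(2), of j] that by (simp add: less_le)
  then have "0 < (if k \<le> j then z - y k else y k - z)" if "k \<in> {1..n}" for k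
    unfolding side_def using that by (metis less_irrefl less_max_iff_disj)
  then show "k \<in> {1..n} \<Longrightarrow> k \<le> j \<Longrightarrow> y k < z" "k \<in> {1..n} \<Longrightarrow> j < k \<Longrightarrow> z < y k" for k
    by (metis diff_gt_0_iff_gt, metis diff_gt_0_iff_gt not_le)
qed

lemma M_posE:
  assumes "nodes y" "M j y > 0"
  obtains z where "z \<in> {0..1}" "M j y = Phi j y z" "w z > 0"
    "\<And>k. k \<in> {1..n} \<Longrightarrow> L k (side j k y z) > 0"
    "\<And>k. k \<in> {1..n} \<Longrightarrow> k \<le> j \<Longrightarrow> y k < z" "\<And>k. k \<in> {1..n} \<Longrightarrow> j < k \<Longrightarrow> z < y k"
proof -
  obtain z where z: "z \<in> {0..1}" "M j y = Phi j y z" using M_attained[OF assms(1)] by metis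
  then have "Phi j y z > 0" using assms(2) by simp
  show ?thesis
    by (rule that[OF z Phi_posD[OF assms(1) z(1) \<open>Phi j y z > 0\<close>]])
qed

section \<open>Continuity of the maxima in the nodes\<close>

text \<open>The clamped distance is 1-Lipschitz in the node, uniformly in \<open>t\<close>, and
  \<open>L k\<close> is uniformly continuous.\<close>

lemma uniform_limit_L_side:
  assumes lim: "((\<lambda>m. v m k) \<longlongrightarrow> y k) F" and v: "\<forall>\<^sub>F m in F. nodes (v m)" and y: "nodes y"
    and k: "k \<in> {1..n}"
  shows "uniform_limit {0..1} (\<lambda>m t. L k (side j k (v m) t)) (\<lambda>t. L k (side j k y t)) F"
proof (rule uniform_limitI)
  fix e :: real assume "e > 0"
  have "uniformly_continuous_on {0..1} (L k)"
    by (intro compact_uniformly_continuous L_cont k) auto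
  then obtain d where d: "d > 0"
    "\<And>a b. a \<in> {0..1} \<Longrightarrow> b \<in> {0..1} \<Longrightarrow> dist b a < d \<Longrightarrow> dist (L k b) (L k a) < e"
    using \<open>e > 0\<close> unfolding uniformly_continuous_on_def by metis
  have "\<forall>\<^sub>F m in F. dist (v m k) (y k) < d" using lim d(1) by (rule tendstoD)
  with v show "\<forall>\<^sub>F m in F. \<forall>t\<in>{0..1}. dist (L k (side j k (v m) t)) (L k (side j k y t)) < e"
  proof eventually_elim
    case (elim m)
    then have "dist (side j k (v m) t) (side j k y t) < d" for t
      by (auto simp: side_def dist_real_def max_def)
    then show ?case using elim y k by (intro ballI d(2) side_mem) auto
  qed
qed

text \<open>The functions \<open>Phi\<close> converge uniformly, hence so do their suprema. The
  filter is arbitrary because both sequences and limits from the right are needed.\<close>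

lemma M_tendsto:
  assumes lim: "\<And>k. k \<in> {1..n} \<Longrightarrow> ((\<lambda>m. v m k) \<longlongrightarrow> y k) F"
    and v: "\<forall>\<^sub>F m in F. nodes (v m)" and y: "nodes y"
  shows "((\<lambda>m. M j (v m)) \<longlongrightarrow> M j y) F"
proof -
  have bdd: "bounded ((\<lambda>t. \<Prod>k\<in>K. L k (side j k y t)) ` {0..1})" if "K \<subseteq> {1..n}" for K
    using continuous_on_prod_L_side[OF y that]
    by (intro compact_imp_bounded compact_continuous_image) auto
  have "uniform_limit {0..1} (\<lambda>m t. \<Prod>k\<in>K. L k (side j k (v m) t))
      (\<lambda>t. \<Prod>k\<in>K. L k (side j k y t)) F" if "K \<subseteq> {1..n}" for K
  proof -
    have "finite K" using that finite_subset by auto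
    then show ?thesis using that
    proof (induction K)
      case empty
      then show ?case by (simp add: uniform_limit_const)
    next
      case (insert k K)
      have "bounded ((\<lambda>t. L k (side j k y t)) ` {0..1})" using bdd[of "{k}"] insert.prems by simp
      then show ?case
        using insert uniform_lim_mult[OF uniform_limit_L_side[OF lim v y] _ _ bdd[of K]] by simp
    qed
  qed
  \<comment> \<open>Products of uniform limits require bounded limits; \<open>w\<close> is bounded
    by its maximum although it may be discontinuous.\<close>
  moreover have "bounded (w ` {0..1})"
  proof -
    obtain z where "z \<in> {0..1}" "\<forall>t\<in>{0..1}. w t \<le> w z"
      using usc_on_attains_sup[OF _ _ w_usc] by auto
    then show ?thesis using w_nonneg by (intro boundedI[of _ "w z"]) auto
  qed
  ultimately have unif: "uniform_limit {0..1} (\<lambda>m. Phi j (v m)) (Phi j y) F"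
    unfolding Phi_def[abs_def] by (intro uniform_lim_mult uniform_limit_const bdd) auto
  show ?thesis
  proof (rule tendstoI)
    fix e :: real assume "e > 0"
    with unif have "\<forall>\<^sub>F m in F. \<forall>t\<in>{0..1}. dist (Phi j (v m) t) (Phi j y t) < e"
      by (rule uniform_limitD)
    with v show "\<forall>\<^sub>F m in F. dist (M j (v m)) (M j y) < e"
    proof eventually_elim
      case (elim m)
      \<comment> \<open>A maximum point of each function is used as a test point for the
        other.\<close>
      obtain z where z: "z \<in> {0..1}" "M j (v m) = Phi j (v m) z"
        using M_attained[OF elim(1)] by metis
      obtain z' where z': "z' \<in> {0..1}" "M j y = Phi j y z'"
        using M_attained[OF y] by metis
      have "\<bar>Phi j (v m) z - Phi j y z\<bar> < e" "\<bar>Phi j (v m) z' - Phi j y z'\<bar> < e"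
        using elim(2) z z' by (auto simp: dist_real_def)
      moreover have "Phi j y z \<le> M j y" "Phi j (v m) z' \<le> M j (v m)"
        by (intro M_upper y elim(1) z(1) z'(1))+
      ultimately show ?case using z z' by (auto simp: dist_real_def)
    qed
  qed
qed

section \<open>Monotonicity of quotients of neighbouring maxima, and a positive maximum\<close>

lemma L_four_points:
  "k \<in> {1..n} \<Longrightarrow> 0 \<le> p \<Longrightarrow> p \<le> q \<Longrightarrow> p \<le> r \<Longrightarrow> s \<le> 1 \<Longrightarrow> q + r = p + s \<Longrightarrow>
    L k p * L k s \<le> L k q * L k r"
  by (rule log_concave_four_points[OF L_cont L_nonneg L_zero L_pos L_logconc])

lemma Phi_mult: "Phi i x s * Phi j y t =
    (w s * w t) * (\<Prod>k\<in>{1..n}. L k (side i k x s) * L k (side j k y t))"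
  by (simp add: Phi_def prod.distrib)

text \<open>With \<open>t\<close> a maximum point for \<open>M j y\<close> and \<open>s\<close> one
  for \<open>M (j - 1) u\<close>, the maxima on the right are tested at \<open>t\<close> and
  \<open>s\<close>. For each \<open>k\<close> other than \<open>j\<close>, the four distances have
  equal pair sums, and the left side pairs the smallest with the largest. The cross-multiplied form
  admits vanishing maxima.\<close>

lemma M_cross_le:
  assumes y: "nodes y" and u: "nodes u" and le: "\<And>k. k \<in> {1..n} \<Longrightarrow> y k \<le> u k"
    and j: "j \<in> {1..n}" and eq: "y j = u j"
  shows "M j y * M (j - 1) u \<le> M j u * M (j - 1) y"
proof (cases "M j y > 0 \<and> M (j - 1) u > 0")
  case False
  then have "M j y * M (j - 1) u = 0"
    using M_nonneg[OF y, of j] M_nonneg[OF u, of "j - 1"] by (auto simp: less_le)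
  then show ?thesis
    using mult_nonneg_nonneg[OF M_nonneg[OF u, of j] M_nonneg[OF y, of "j - 1"]] by linarith
next
  case True
  obtain t where t: "t \<in> {0..1}" "M j y = Phi j y t" "w t > 0"
    "\<And>k. k \<in> {1..n} \<Longrightarrow> k \<le> j \<Longrightarrow> y k < t" "\<And>k. k \<in> {1..n} \<Longrightarrow> j < k \<Longrightarrow> t < y k"
    using M_posE[OF y] True by metis
  obtain s where s: "s \<in> {0..1}" "M (j - 1) u = Phi (j - 1) u s" "w s > 0"
    "\<And>k. k \<in> {1..n} \<Longrightarrow> k \<le> j - 1 \<Longrightarrow> u k < s" "\<And>k. k \<in> {1..n} \<Longrightarrow> j - 1 < k \<Longrightarrow> s < u k"
    using M_posE[OF u] True by metis
  \<comment> \<open>The common \<open>j\<close>-th node separates \<open>s\<close> from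
    \<open>t\<close>; every other index has its nodes on one and the same side of both
    points.\<close>
  have st: "s < y j" "y j < t" using s(5)[of j] t(4)[of j] j eq by auto
  have factor: "L k (side j k y t) * L k (side (j - 1) k u s)
      \<le> L k (side j k u t) * L k (side (j - 1) k y s)" if k: "k \<in> {1..n}" for k
  proof -
    consider "k < j" | "k = j" | "k > j" by linarith
    then show ?thesis
    proof cases
      case 1
      have "u k < s" using s(4) 1 k by auto
      moreover have "0 \<le> y k" using nodes_bounds[OF y k] by simp
      ultimately have "L k (s - u k) * L k (t - y k) \<le> L k (t - u k) * L k (s - y k)"
        using le[OF k] st t(1) by (intro L_four_points k) auto
      moreover have "k \<le> j - 1" using 1 by simp
      ultimately show ?thesis
        using \<open>u k < s\<close> 1 le[OF k] st by (simp add: side_def max_def mult.commute)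
    next
      case 2
      then have "\<not> k \<le> j - 1" using j by auto
      then show ?thesis using 2 eq by (simp add: side_def)
    next
      case 3
      have "t < y k" using t(5) 3 k by auto
      moreover have "u k \<le> 1" using nodes_bounds[OF u k] by simp
      ultimately have "L k (y k - t) * L k (u k - s) \<le> L k (u k - t) * L k (y k - s)"
        using le[OF k] st s(1) by (intro L_four_points k) auto
      moreover have "\<not> k \<le> j - 1" using 3 by simp
      ultimately show ?thesis using \<open>t < y k\<close> 3 le[OF k] st by (simp add: side_def max_def)
    qed
  qed
  have "M j y * M (j - 1) u \<le> Phi j u t * Phi (j - 1) y s"
    unfolding t(2) s(2) Phi_mult using t s y u factor
    by (intro mult_left_mono prod_mono) (auto intro!: mult_nonneg_nonneg L_side_nonneg)
  also have "\<dots> \<le> M j u * M (j - 1) y"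
    by (intro mult_mono M_upper M_nonneg Phi_nonneg y u t(1) s(1))
  finally show ?thesis .
qed

text \<open>A maximum point for \<open>u\<close> still works for \<open>y\<close>: nodes to its left
  only move left, and those to its right stay at or beyond the fixed \<open>j\<close>-th node. This
  permits cancelling \<open>M (j - 1) y\<close> from inequalities.\<close>

lemma M_pos_downward:
  assumes y: "nodes y" and u: "nodes u" and le: "\<And>k. k \<in> {1..n} \<Longrightarrow> y k \<le> u k"
    and j: "j \<in> {1..n}" and eq: "y j = u j" and pos: "M (j - 1) u > 0"
  shows "M (j - 1) y > 0"
proof -
  obtain s where s: "s \<in> {0..1}" "w s > 0" "\<And>k. k \<in> {1..n} \<Longrightarrow> L k (side (j - 1) k u s) > 0"
    "\<And>k. k \<in> {1..n} \<Longrightarrow> k \<le> j - 1 \<Longrightarrow> u k < s" "\<And>k. k \<in> {1..n} \<Longrightarrow> j - 1 < k \<Longrightarrow> s < u k"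
    using M_posE[OF u pos] by metis
  have "s < y j" using s(5) j eq by auto
  then have "s < 1" using nodes_bounds[OF y j] by simp
  have "L k (side (j - 1) k y s) > 0" if k: "k \<in> {1..n}" for k
  proof (cases "k \<le> j - 1")
    case True
    then have "y k < s" "0 \<le> y k" using s(4)[OF k] le[OF k] y k by (auto simp: nodes_def)
    then show ?thesis using True \<open>s < 1\<close> k by (auto simp: side_def intro!: L_pos)
  next
    case False
    then have "y j \<le> y k" using y j k by (auto intro: nodes_mono)
    then have "s < y k" using \<open>s < y j\<close> by simp
    have "u k \<le> 1" using nodes_bounds[OF u k] by simp
    show ?thesis
    proof (cases "y k = u k")
      case True
      then have "side (j - 1) k y s = side (j - 1) k u s" by (simp add: side_def)
      then show ?thesis using s(3)[OF k] by simp
    next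
      \<comment> \<open>\<open>L k\<close> may vanish at 1, so the argument has to be kept away from 1.\<close>
      case neq: False
      then have "y k - s < 1" using le[OF k] \<open>u k \<le> 1\<close> s(1) by auto
      then show ?thesis using False \<open>s < y k\<close> k by (auto simp: side_def intro!: L_pos)
    qed
  qed
  then have "Phi (j - 1) y s > 0"
    unfolding Phi_def using s(2) by (intro mult_pos_pos prod_pos) auto
  then show ?thesis using M_upper[OF y s(1), of "j - 1"] by linarith
qed

text \<open>The \<open>n\<close> nodes cannot cover \<open>n + 1\<close> points where
  \<open>w\<close> is nonzero; a point left over lies strictly inside one of the intervals.\<close>

lemma exists_M_pos:
  assumes y: "nodes y"
  shows "\<exists>j\<le>n. M j y > 0"
proof -
  obtain S where S: "S \<subseteq> {t \<in> {0<..<1}. w t \<noteq> 0}" "finite S" "card S = n + 1"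
    using w_points by auto
  have "card (y ` {1..n}) \<le> n" using card_image_le[of "{1..n}" y] by simp
  then have "\<not> S \<subseteq> y ` {1..n}" using card_mono[of "y ` {1..n}" S] S by auto
  then obtain s where s: "s \<in> S" "s \<notin> y ` {1..n}" by auto
  have s01: "0 < s" "s < 1" and "w s > 0"
    using S s(1) w_nonneg[of s] by (auto simp: subset_iff less_le)
  \<comment> \<open>The index of the last node to the left of \<open>s\<close>, with 0 if there is
    none.\<close>
  define j where "j = Max (insert 0 {k\<in>{1..n}. y k < s})"
  have j: "j \<in> insert 0 {k\<in>{1..n}. y k < s}" unfolding j_def by (rule Max_in) auto
  have jge: "k \<le> j" if "k \<in> {1..n}" "y k < s" for k
    unfolding j_def using that by (intro Max_ge) auto
  have "L k (side j k y s) > 0" if k: "k \<in> {1..n}" for k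
  proof (cases "k \<le> j")
    case True
    then have "j \<in> {1..n}" "y j < s" using j k by auto
    moreover from this have "y k \<le> y j" using y k True by (auto intro: nodes_mono)
    moreover have "0 \<le> y k" using nodes_bounds[OF y k] by simp
    ultimately show ?thesis using True s01 k by (auto simp: side_def intro!: L_pos)
  next
    case False
    then have "\<not> y k < s" "y k \<noteq> s" using jge[OF k] s(2) k by auto
    moreover have "y k \<le> 1" using nodes_bounds[OF y k] by simp
    ultimately show ?thesis using False s01 k by (auto simp: side_def intro!: L_pos)
  qed
  then have "Phi j y s > 0"
    unfolding Phi_def using \<open>w s > 0\<close> by (intro mult_pos_pos prod_pos) auto
  then have "M j y > 0" using M_upper[OF y, of s j] s01 by auto
  moreover have "j \<le> n" using j by auto
  ultimately show ?thesis by blast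
qed

section \<open>Subsolutions and existence\<close>

text \<open>The quotients \<open>M j y / \<alpha> j\<close> increase weakly with \<open>j\<close>,
  written without division.\<close>

definition subsolution :: "(nat \<Rightarrow> real) \<Rightarrow> (nat \<Rightarrow> real) \<Rightarrow> bool" where
  "subsolution \<alpha> y \<longleftrightarrow> nodes y \<and> (\<forall>j\<in>{1..n}. \<alpha> j * M (j - 1) y \<le> \<alpha> (j - 1) * M j y)"

text \<open>If \<open>M (j - 1) u\<close> is positive, so is \<open>M (j - 1) y\<close>; the
  hypothesis multiplied by the former combines with the cross inequality, and the latter
  cancels.\<close>

lemma subsolution_ineq_mono:
  assumes y: "nodes y" and u: "nodes u" and le: "\<And>k. k \<in> {1..n} \<Longrightarrow> y k \<le> u k"
    and j: "j \<in> {1..n}" and eq: "y j = u j" and \<alpha>: "\<alpha> j > 0" "\<alpha> (j - 1) > 0"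
    and ineq: "\<alpha> j * M (j - 1) y \<le> \<alpha> (j - 1) * M j y"
  shows "\<alpha> j * M (j - 1) u \<le> \<alpha> (j - 1) * M j u"
proof (cases "M (j - 1) u > 0")
  case False
  then have "M (j - 1) u = 0" using M_nonneg[OF u, of "j - 1"] by simp
  then show ?thesis using M_nonneg[OF u] \<alpha> by simp
next
  case True
  then have pos: "M (j - 1) y > 0" using M_pos_downward[OF y u le j eq] by simp
  have "(\<alpha> j * M (j - 1) u) * M (j - 1) y = (\<alpha> j * M (j - 1) y) * M (j - 1) u" by simp
  also have "\<dots> \<le> (\<alpha> (j - 1) * M j y) * M (j - 1) u"
    using ineq True by simp
  also have "\<dots> = \<alpha> (j - 1) * (M j y * M (j - 1) u)" by simp
  also have "\<dots> \<le> \<alpha> (j - 1) * (M j u * M (j - 1) y)"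
    using M_cross_le[OF y u le j eq] \<alpha> by simp
  also have "\<dots> = (\<alpha> (j - 1) * M j u) * M (j - 1) y" by simp
  finally show ?thesis using pos by simp
qed

lemma nodes_max:
  assumes "nodes x" "nodes y"
  shows "nodes (\<lambda>k. max (x k) (y k))"
proof (rule nodesI)
  fix k assume "k \<in> {1..n}"
  then show "0 \<le> max (x k) (y k)" "max (x k) (y k) \<le> 1"
    using assms nodes_bounds by (auto simp: le_max_iff_disj)
qed (intro max.mono nodes_mono assms)

text \<open>At each index \<open>j\<close> the maximum agrees with one of the two systems in the
  \<open>j\<close>-th node and dominates it elsewhere, so it inherits that system's
  \<open>j\<close>-th inequality.\<close>

lemma subsolution_max:
  assumes \<alpha>: "\<And>j. j \<le> n \<Longrightarrow> \<alpha> j > 0" and x: "subsolution \<alpha> x" and y: "subsolution \<alpha> y"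
  shows "subsolution \<alpha> (\<lambda>k. max (x k) (y k))"
  unfolding subsolution_def
proof (intro conjI ballI)
  show u: "nodes (\<lambda>k. max (x k) (y k))" using nodes_max x y by (simp add: subsolution_def)
  fix j assume j: "j \<in> {1..n}"
  have \<alpha>j: "\<alpha> j > 0" "\<alpha> (j - 1) > 0" using \<alpha> j by auto
  show "\<alpha> j * M (j - 1) (\<lambda>k. max (x k) (y k)) \<le> \<alpha> (j - 1) * M j (\<lambda>k. max (x k) (y k))"
  proof (cases "y j \<le> x j")
    case True
    show ?thesis
      by (rule subsolution_ineq_mono[where y = x and \<alpha> = \<alpha>, OF _ u _ j _ \<alpha>j])
        (use True x j in \<open>auto simp: subsolution_def\<close>)
  next
    case False
    show ?thesis
      by (rule subsolution_ineq_mono[where y = y and \<alpha> = \<alpha>, OF _ u _ j _ \<alpha>j])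
        (use False y j in \<open>auto simp: subsolution_def\<close>)
  qed
qed

text \<open>With all nodes at 0 every interval but the last degenerates, so the left sides vanish.
  This makes the set of subsolutions nonempty.\<close>

lemma subsolution_zero:
  assumes \<alpha>: "\<And>j. j \<le> n \<Longrightarrow> \<alpha> j > 0"
  shows "subsolution \<alpha> (\<lambda>_. 0)"
proof -
  have 0: "nodes (\<lambda>_. 0)" by (auto simp: nodes_def mono_on_def)
  have "M (j - 1) (\<lambda>_. 0) = 0" if j: "j \<in> {1..n}" for j
  proof (rule ccontr)
    assume "M (j - 1) (\<lambda>_. 0) \<noteq> 0"
    then have "M (j - 1) (\<lambda>_. 0) > 0" using M_nonneg[OF 0, of "j - 1"] by simp
    then show False
    proof (rule M_posE[OF 0])
      fix z :: real
      assume "z \<in> {0..1}" "\<And>k. k \<in> {1..n} \<Longrightarrow> j - 1 < k \<Longrightarrow> z < 0"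
      then show False using j by force
    qed
  qed
  then show ?thesis
    using 0 \<alpha> M_nonneg[OF 0] by (auto simp: subsolution_def less_imp_le)
qed

text \<open>The candidate is the coordinatewise supremum. Closure under maxima yields one
  subsolution close to it in all coordinates at once, and continuity of \<open>M\<close> passes the
  inequalities to the limit.\<close>

lemma greatest_subsolution:
  assumes \<alpha>: "\<And>j. j \<le> n \<Longrightarrow> \<alpha> j > 0"
  obtains y where "subsolution \<alpha> y" "\<And>v k. subsolution \<alpha> v \<Longrightarrow> k \<in> {1..n} \<Longrightarrow> v k \<le> y k"
proof -
  define y where "y k = Sup ((\<lambda>v. v k) ` {v. subsolution \<alpha> v})" for k
  have ne: "{v. subsolution \<alpha> v} \<noteq> {}" using subsolution_zero[of \<alpha>, OF \<alpha>] by auto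
  have upper: "v k \<le> y k" if "subsolution \<alpha> v" "k \<in> {1..n}" for v k
    unfolding y_def using that
    by (intro cSup_upper bdd_aboveI[of _ 1]) (auto simp: subsolution_def nodes_def)
  have least: "y k \<le> b" if "\<And>v. subsolution \<alpha> v \<Longrightarrow> v k \<le> b" for k b
    unfolding y_def using ne that by (intro cSup_least) auto
  have y: "nodes y"
  proof (rule nodesI)
    fix k assume k: "k \<in> {1..n}"
    show "0 \<le> y k" using upper[OF subsolution_zero k] \<alpha> by simp
    show "y k \<le> 1" using k by (intro least) (auto simp: subsolution_def nodes_def)
  next
    fix i k assume ik: "i \<in> {1..n}" "k \<in> {1..n}" "i \<le> k"
    show "y i \<le> y k"
    proof (rule least)
      fix v assume v: "subsolution \<alpha> v"
      then have "v i \<le> v k" using ik nodes_mono by (simp add: subsolution_def)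
      then show "v i \<le> y k" using upper[OF v ik(2)] by simp
    qed
  qed
  have approx: "\<exists>v. subsolution \<alpha> v \<and> (\<forall>k\<in>K. y k - e < v k)" if "e > 0" "finite K" for e K
    using \<open>finite K\<close>
  proof (induction K)
    case empty
    then show ?case using ne by auto
  next
    case (insert k K)
    then obtain v where v: "subsolution \<alpha> v" "\<forall>k\<in>K. y k - e < v k" by auto
    have "\<exists>x. subsolution \<alpha> x \<and> y k - e < x k"
    proof (rule ccontr)
      assume "\<not> ?thesis"
      then have "y k \<le> y k - e" by (intro least) (auto simp: not_less)
      then show False using \<open>e > 0\<close> by simp
    qed
    then obtain x where x: "subsolution \<alpha> x" "y k - e < x k" by auto
    show ?case
      using subsolution_max[of \<alpha>, OF \<alpha> v(1) x(1)] v(2) x(2) by (auto simp: less_max_iff_disj)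
  qed
  have "\<exists>v. subsolution \<alpha> v \<and> (\<forall>k\<in>{1..n}. y k - 1 / real (Suc m) < v k)" for m
    by (rule approx) auto
  then obtain v where v: "\<And>m. subsolution \<alpha> (v m)"
    "\<And>m k. k \<in> {1..n} \<Longrightarrow> y k - 1 / real (Suc m) < v m k" by metis
  have lim: "(\<lambda>m. v m k) \<longlonglongrightarrow> y k" if k: "k \<in> {1..n}" for k
  proof (rule tendsto_sandwich)
    have "(\<lambda>m. y k - 1 / real (Suc m)) \<longlonglongrightarrow> y k - 0"
      by (intro tendsto_intros LIMSEQ_Suc[OF lim_1_over_n])
    then show "(\<lambda>m. y k - 1 / real (Suc m)) \<longlonglongrightarrow> y k" by simp
    show "\<forall>\<^sub>F m in sequentially. y k - 1 / real (Suc m) \<le> v m k"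
      using v(2)[OF k] by (intro always_eventually) (auto simp: less_imp_le)
    show "\<forall>\<^sub>F m in sequentially. v m k \<le> y k"
      using upper[OF v(1) k] by (intro always_eventually) auto
  qed auto
  have Mlim: "(\<lambda>m. M j (v m)) \<longlonglongrightarrow> M j y" for j
    using v(1) y by (intro M_tendsto lim always_eventually) (auto simp: subsolution_def)
  have "\<alpha> j * M (j - 1) y \<le> \<alpha> (j - 1) * M j y" if j: "j \<in> {1..n}" for j
  proof (rule tendsto_le[OF sequentially_bot])
    show "(\<lambda>m. \<alpha> (j - 1) * M j (v m)) \<longlonglongrightarrow> \<alpha> (j - 1) * M j y"
      "(\<lambda>m. \<alpha> j * M (j - 1) (v m)) \<longlonglongrightarrow> \<alpha> j * M (j - 1) y"
      by (intro tendsto_intros Mlim)+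
    show "\<forall>\<^sub>F m in sequentially. \<alpha> j * M (j - 1) (v m) \<le> \<alpha> (j - 1) * M j (v m)"
      using v(1) j by (intro always_eventually) (auto simp: subsolution_def)
  qed
  then have "subsolution \<alpha> y" using y by (simp add: subsolution_def)
  then show ?thesis using that upper by blast
qed

text \<open>
  A strict inequality in the \<open>j\<close>-th condition would leave room to move the \<open>j\<close>-th node of the
  greatest subsolution to the right.
\<close>
lemma equioscillation_exists:
  assumes \<alpha>: "\<And>j. j \<le> n \<Longrightarrow> \<alpha> j > 0"
  obtains y C where "nodes y" "C > 0" "\<And>j. j \<le> n \<Longrightarrow> C * M j y = \<alpha> j"
proof -
  obtain y where sub: "subsolution \<alpha> y"
    and great: "\<And>v k. subsolution \<alpha> v \<Longrightarrow> k \<in> {1..n} \<Longrightarrow> v k \<le> y k"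
    using greatest_subsolution[of \<alpha>, OF \<alpha>] by metis
  have y: "nodes y" using sub by (simp add: subsolution_def)
  have eq: "\<alpha> j * M (j - 1) y = \<alpha> (j - 1) * M j y" if j: "j \<in> {1..n}" for j
  proof (rule ccontr)
    assume "\<alpha> j * M (j - 1) y \<noteq> \<alpha> (j - 1) * M j y"
    then have less: "\<alpha> j * M (j - 1) y < \<alpha> (j - 1) * M j y"
      using sub j by (force simp: subsolution_def less_le)
    have \<alpha>j: "\<alpha> j > 0" "\<alpha> (j - 1) > 0" using \<alpha> j by auto
    have "0 \<le> \<alpha> j * M (j - 1) y" using \<alpha>j M_nonneg[OF y] by simp
    then have "M j y > 0" using less \<alpha>j by (metis order_le_less_trans zero_less_mult_pos)
    then obtain z where z: "z \<in> {0..1}" "\<And>k. k \<in> {1..n} \<Longrightarrow> k \<le> j \<Longrightarrow> y k < z"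
      "\<And>k. k \<in> {1..n} \<Longrightarrow> j < k \<Longrightarrow> z < y k"
      using M_posE[OF y] by metis
    \<comment> \<open>Since \<open>z\<close> lies to the right of the \<open>j\<close>-th node and
      to the left of all later ones, a shift by less than \<open>z - y j\<close> keeps the
      order.\<close>
    define v where "v h = y(j := y j + h)" for h
    have yj: "y j < z" using z(2)[OF j] by simp
    have nodes_v: "nodes (v h)" if h: "0 < h" "h < z - y j" for h
    proof (rule nodesI)
      fix k assume "k \<in> {1..n}"
      then have "0 \<le> y k" "y k \<le> 1" using y by (auto simp: nodes_def)
      then show "0 \<le> v h k" "v h k \<le> 1" using h z(1) by (auto simp: v_def)
    next
      fix i k assume ik: "i \<in> {1..n}" "k \<in> {1..n}" "i \<le> k"
      then have "y i \<le> y k" using y by (intro nodes_mono)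
      then show "v h i \<le> v h k" using h z(3)[OF ik(2)] ik by (auto simp: v_def)
    qed
    have ev: "\<forall>\<^sub>F h in at_right 0. 0 < h \<and> h < z - y j"
      using eventually_at_right_real[of 0 "z - y j"] yj by simp
    have "((\<lambda>h. v h k) \<longlongrightarrow> y k) (at_right 0)" for k
    proof (cases "k = j")
      case True
      have "((\<lambda>h. y j + h) \<longlongrightarrow> y j + 0) (at_right 0)" by (intro tendsto_intros)
      then show ?thesis using True by (simp add: v_def)
    qed (simp add: v_def)
    then have Mlim: "((\<lambda>h. M i (v h)) \<longlongrightarrow> M i y) (at_right 0)" for i
      using y ev by (intro M_tendsto) (auto elim!: eventually_mono intro: nodes_v)
    have "((\<lambda>h. \<alpha> (j - 1) * M j (v h) - \<alpha> j * M (j - 1) (v h))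
        \<longlongrightarrow> \<alpha> (j - 1) * M j y - \<alpha> j * M (j - 1) y) (at_right 0)"
      by (intro tendsto_intros Mlim)
    then have "\<forall>\<^sub>F h in at_right 0. 0 < \<alpha> (j - 1) * M j (v h) - \<alpha> j * M (j - 1) (v h)"
      by (rule order_tendstoD(1)) (use less in simp)
    then have "\<exists>h. (0 < \<alpha> (j - 1) * M j (v h) - \<alpha> j * M (j - 1) (v h)) \<and> 0 < h \<and> h < z - y j"
      using ev by (intro eventually_happens'[OF _ eventually_conj]) auto
    then obtain h where h: "0 < h" "h < z - y j"
      "\<alpha> j * M (j - 1) (v h) < \<alpha> (j - 1) * M j (v h)" by auto
    \<comment> \<open>The \<open>j\<close>-th inequality survives by continuity; in the others the
      \<open>i\<close>-th node is fixed while a different node moves right.\<close>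
    have "\<alpha> i * M (i - 1) (v h) \<le> \<alpha> (i - 1) * M i (v h)" if i: "i \<in> {1..n}" for i
    proof (cases "i = j")
      case True
      then show ?thesis using h by simp
    next
      case False
      have "\<alpha> i > 0" "\<alpha> (i - 1) > 0" using \<alpha> i by auto
      then show ?thesis
        using False sub i h by (intro subsolution_ineq_mono[OF y nodes_v])
          (auto simp: subsolution_def v_def)
    qed
    then have "subsolution \<alpha> (v h)" using nodes_v h by (simp add: subsolution_def)
    then show False using great[OF _ j, of "v h"] h by (simp add: v_def)
  qed
  have all: "\<alpha> 0 * M j y = \<alpha> j * M 0 y" if "j \<le> n" for j
    using that
  proof (induction j)
    case (Suc j)
    have "\<alpha> j * (\<alpha> 0 * M (Suc j) y) = \<alpha> 0 * (\<alpha> j * M (Suc j) y)" by simp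
    also have "\<dots> = \<alpha> 0 * (\<alpha> (Suc j) * M j y)" using eq[of "Suc j"] Suc.prems by simp
    also have "\<dots> = \<alpha> j * (\<alpha> (Suc j) * M 0 y)" using Suc by simp
    finally show ?case using \<alpha>[of j] Suc.prems by simp
  qed simp
  have \<alpha>0: "\<alpha> 0 > 0" using \<alpha> by simp
  have "M 0 y \<noteq> 0"
  proof
    assume "M 0 y = 0"
    then have "M j y = 0" if "j \<le> n" for j using all[OF that] \<alpha>0 by simp
    then show False using exists_M_pos[OF y] by force
  qed
  then have pos: "M 0 y > 0" using M_nonneg[OF y, of 0] by simp
  show ?thesis
  proof (rule that[of y "\<alpha> 0 / M 0 y"])
    show "\<alpha> 0 / M 0 y * M j y = \<alpha> j" if "j \<le> n" for j
      using all[OF that] pos by (simp add: field_simps)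
  qed (use y pos \<alpha>0 in auto)
qed

section \<open>Translation between good systems and the maxima\<close>

lemma ext_nodes_bounds:
  assumes "nodes y" "j \<le> n"
  shows "ext_nodes n y j \<in> {0..1}" "ext_nodes n y (j + 1) \<in> {0..1}"
  using assms by (auto simp: ext_nodes_def nodes_def)

text \<open>On the \<open>j\<close>-th closed interval every node lies on its expected side, so
  clamping has no effect.\<close>

lemma Phi_eq_prod_abs:
  assumes y: "nodes y" and "j \<le> n" and t: "t \<in> {ext_nodes n y j..ext_nodes n y (j + 1)}"
  shows "Phi j y t = w t * (\<Prod>k\<in>{1..n}. L k \<bar>t - y k\<bar>)"
proof -
  have "side j k y t = \<bar>t - y k\<bar>" if k: "k \<in> {1..n}" for k
  proof (cases "k \<le> j")
    case True
    then have "y k \<le> y j" "y j \<le> t"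
      using y k \<open>j \<le> n\<close> t by (auto intro: nodes_mono simp: ext_nodes_def)
    then show ?thesis using True by (simp add: side_def)
  next
    case False
    then have "y (j + 1) \<le> y k" "t \<le> y (j + 1)"
      using y k \<open>j \<le> n\<close> t by (auto intro: nodes_mono simp: ext_nodes_def)
    then show ?thesis using False by (simp add: side_def)
  qed
  then show ?thesis unfolding Phi_def by simp
qed

lemma Phi_pos_imp_ext_nodes:
  assumes y: "nodes y" and "j \<le> n" and t: "t \<in> {0..1}" and pos: "Phi j y t > 0"
  shows "0 < j \<Longrightarrow> ext_nodes n y j < t" "j < n \<Longrightarrow> t < ext_nodes n y (j + 1)"
    "t \<in> {ext_nodes n y j..ext_nodes n y (j + 1)}"
proof -
  show 1: "0 < j \<Longrightarrow> ext_nodes n y j < t"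
    using Phi_posD(3)[OF y t pos, of j] \<open>j \<le> n\<close> by (auto simp: ext_nodes_def)
  show 2: "j < n \<Longrightarrow> t < ext_nodes n y (j + 1)"
    using Phi_posD(4)[OF y t pos, of "j + 1"] by (auto simp: ext_nodes_def)
  have "j = 0 \<Longrightarrow> ext_nodes n y j = 0" "j = n \<Longrightarrow> ext_nodes n y (j + 1) = 1"
    by (auto simp: ext_nodes_def)
  then show "t \<in> {ext_nodes n y j..ext_nodes n y (j + 1)}"
    using 1 2 t \<open>j \<le> n\<close> by (cases "j = 0"; cases "j = n") auto
qed

text \<open>As \<open>Phi j y\<close> vanishes elsewhere in \<open>{0..1}\<close>, a maximum over
  the \<open>j\<close>-th interval is a maximum over \<open>{0..1}\<close>. Conversely,
  \<open>\<alpha> j > 0\<close> keeps maximum points away from the nodes, which yields the strict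
  order of nodes and maximum points.\<close>

lemma good_system_iff:
  assumes \<alpha>: "\<And>j. j \<le> n \<Longrightarrow> \<alpha> j > 0"
  shows "good_system n L w \<alpha> y C \<longleftrightarrow> nodes y \<and> C > 0 \<and> (\<forall>j\<le>n. C * M j y = \<alpha> j)"
proof
  assume good: "good_system n L w \<alpha> y C"
  let ?e = "ext_nodes n y"
  have C: "C > 0" and e: "\<And>k. k \<le> n \<Longrightarrow> ?e k < ?e (k + 1)"
    using good by (auto simp: good_system_def)
  have mono: "?e i \<le> ?e k" if "i \<le> k" "k \<le> n + 1" for i k
    using that
  proof (induction k rule: dec_induct)
    case (step k)
    then show ?case using e[of k] by simp
  qed simp
  have y: "nodes y"
  proof (rule nodesI)
    fix k assume "k \<in> {1..n}"
    then show "0 \<le> y k" "y k \<le> 1"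
      using mono[of 0 k] mono[of k "n + 1"] by (auto simp: ext_nodes_def)
  next
    fix i k assume "i \<in> {1..n}" "k \<in> {1..n}" "i \<le> k"
    then show "y i \<le> y k" using mono[of i k] by (auto simp: ext_nodes_def)
  qed
  moreover have "C * M j y = \<alpha> j" if j: "j \<le> n" for j
  proof -
    let ?G = "\<lambda>t. C * w t * (\<Prod>k\<in>{1..n}. L k \<bar>t - y k\<bar>)"
    obtain Z where Z: "\<forall>j\<le>n.
        (j = 0 \<longrightarrow> 0 \<le> Z j) \<and> (0 < j \<longrightarrow> ?e j < Z j) \<and>
        (j < n \<longrightarrow> Z j < ?e (j + 1)) \<and> (j = n \<longrightarrow> Z j \<le> 1) \<and>
        ?G (Z j) = \<alpha> j \<and> (\<forall>t\<in>{?e j .. ?e (j + 1)}. ?G t \<le> ?G (Z j))"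
      using good unfolding good_system_def Let_def by (elim conjE exE)
    define z where "z = Z j"
    have z: "j = 0 \<longrightarrow> 0 \<le> z" "0 < j \<longrightarrow> ?e j < z" "j < n \<longrightarrow> z < ?e (j + 1)"
      "j = n \<longrightarrow> z \<le> 1" "?G z = \<alpha> j" "\<forall>t\<in>{?e j..?e (j + 1)}. ?G t \<le> ?G z"
      using Z[THEN spec, THEN mp, OF j] unfolding z_def by blast+
    have "j = 0 \<Longrightarrow> ?e j = 0" "j = n \<Longrightarrow> ?e (j + 1) = 1"
      by (auto simp: ext_nodes_def)
    then have zin: "z \<in> {?e j..?e (j + 1)}"
      using z(1-4) j by (cases "j = 0"; cases "j = n") auto
    then have z01: "z \<in> {0..1}" using ext_nodes_bounds[OF y j] by auto
    have Phi_z: "C * Phi j y z = \<alpha> j"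
      using z(5) Phi_eq_prod_abs[OF y j zin] by (simp add: mult.assoc)
    have "C * Phi j y t \<le> \<alpha> j" if t: "t \<in> {0..1}" for t
    proof (cases "Phi j y t > 0")
      case True
      then have "t \<in> {?e j..?e (j + 1)}" using Phi_pos_imp_ext_nodes(3)[OF y j t] by simp
      then show ?thesis
        using z(5) bspec[OF z(6), of t] Phi_eq_prod_abs[OF y j, of t] by (simp add: mult.assoc)
    next
      case False
      then have "Phi j y t = 0" using Phi_nonneg[OF y t, of j] by simp
      then show ?thesis using \<alpha>[OF j] by simp
    qed
    then have "C * M j y \<le> \<alpha> j" using M_attained[OF y, of j] by metis
    moreover have "\<alpha> j \<le> C * M j y"
      unfolding Phi_z[symmetric] using M_upper[OF y z01, of j] C by simp
    ultimately show ?thesis by simp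
  qed
  ultimately show "nodes y \<and> C > 0 \<and> (\<forall>j\<le>n. C * M j y = \<alpha> j)" using C by simp
next
  assume rhs: "nodes y \<and> C > 0 \<and> (\<forall>j\<le>n. C * M j y = \<alpha> j)"
  then have y: "nodes y" and C: "C > 0" by auto
  let ?e = "ext_nodes n y"
  have "\<exists>z. z \<in> {0..1} \<and> M j y = Phi j y z" for j using M_attained[OF y] by metis
  then obtain z where z: "\<And>j. z j \<in> {0..1}" "\<And>j. M j y = Phi j y (z j)" by metis
  have CPhi: "C * Phi j y (z j) = \<alpha> j" if "j \<le> n" for j
    using rhs that by (simp flip: z(2))
  have pos: "Phi j y (z j) > 0" if "j \<le> n" for j
  proof -
    have "C * Phi j y (z j) > 0" using \<alpha>[OF that] CPhi[OF that] by simp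
    then show ?thesis using C zero_less_mult_pos by blast
  qed
  note ext = Phi_pos_imp_ext_nodes[OF y _ z(1) pos]
  have e_less: "?e j < ?e (j + 1)" if j: "j \<le> n" for j
  proof (cases "0 < j \<or> j < n")
    case True
    then show ?thesis using ext(1-3)[OF j j] by auto
  next
    \<comment> \<open>Here \<open>n = 0\<close>, and the only interval is
      \<open>{0..1}\<close>.\<close>
    case False
    then show ?thesis using j by (auto simp: ext_nodes_def)
  qed
  have G_z: "C * w (z j) * (\<Prod>k\<in>{1..n}. L k \<bar>z j - y k\<bar>) = \<alpha> j" if j: "j \<le> n" for j
    using Phi_eq_prod_abs[OF y j ext(3)[OF j j]] CPhi[OF j] by (simp add: mult.assoc)
  have G_le: "C * w t * (\<Prod>k\<in>{1..n}. L k \<bar>t - y k\<bar>)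
      \<le> C * w (z j) * (\<Prod>k\<in>{1..n}. L k \<bar>z j - y k\<bar>)"
    if j: "j \<le> n" and t: "t \<in> {?e j..?e (j + 1)}" for j t
  proof -
    have "t \<in> {0..1}" using ext_nodes_bounds[OF y j] t by auto
    then have "C * Phi j y t \<le> C * M j y" using M_upper[OF y] C by simp
    then show ?thesis
      unfolding G_z[OF j] using Phi_eq_prod_abs[OF y j t] rhs j by (simp add: mult.assoc)
  qed
  show "good_system n L w \<alpha> y C"
    unfolding good_system_def Let_def
    by (intro conjI C exI[of _ z] allI impI ballI e_less G_z G_le) (use ext z(1) in auto)
qed

end

section \<open>Strict comparison of the outer maxima and uniqueness\<close>

locale log_concave_translates_deriv = log_concave_translates +
  fixes c :: real
  assumes c_pos: "c > 0"
    and L_deriv: "\<And>j. j \<in> {1..n} \<Longrightarrow>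
        AE t in lborel. t \<in> {0<..<1} \<longrightarrow>
          (\<exists>D. ((\<lambda>s. ln (L j s / L j (1 - s))) has_real_derivative D) (at t) \<and> D \<ge> c)"
begin

lemma L_strict_product:
  "k \<in> {1..n} \<Longrightarrow> 0 < a \<Longrightarrow> 0 < b \<Longrightarrow> 0 < h \<Longrightarrow> a + b + h \<le> 1 \<Longrightarrow>
    L k a * L k b < L k (a + h) * L k (b + h)"
  by (rule log_concave_strict_product[OF L_cont L_nonneg L_zero L_pos L_logconc c_pos L_deriv])

text \<open>All nodes lie to the left of the last interval and to the right of the first. With
  \<open>t\<close> and \<open>s\<close> maximum points for \<open>M n u\<close> and
  \<open>M 0 y\<close>, replacing \<open>t - u k\<close> by \<open>t - y k\<close> and
  \<open>y k - s\<close> by \<open>u k - s\<close> lengthens both distances by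
  \<open>u k - y k\<close>, so the strict product inequality applies.\<close>

lemma M_outer_cross_less:
  assumes y: "nodes y" and u: "nodes u" and le: "\<And>k. k \<in> {1..n} \<Longrightarrow> y k \<le> u k"
    and i: "i \<in> {1..n}" "y i < u i" and pos: "M n u > 0" "M 0 y > 0"
  shows "M n u * M 0 y < M n y * M 0 u"
proof -
  obtain t where t: "t \<in> {0..1}" "M n u = Phi n u t" "w t > 0"
    "\<And>k. k \<in> {1..n} \<Longrightarrow> L k (side n k u t) > 0" "\<And>k. k \<in> {1..n} \<Longrightarrow> k \<le> n \<Longrightarrow> u k < t"
    using M_posE[OF u pos(1)] by metis
  obtain s where s: "s \<in> {0..1}" "M 0 y = Phi 0 y s" "w s > 0"
    "\<And>k. k \<in> {1..n} \<Longrightarrow> L k (side 0 k y s) > 0" "\<And>k. k \<in> {1..n} \<Longrightarrow> 0 < k \<Longrightarrow> s < y k"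
    using M_posE[OF y pos(2)] by metis
  have less: "L k (side n k u t) * L k (side 0 k y s) < L k (side n k y t) * L k (side 0 k u s)"
    if k: "k \<in> {1..n}" "y k < u k" for k
  proof -
    have "u k < t" "s < y k" using t(5) s(5) k by auto
    then have "L k (t - u k) * L k (y k - s)
        < L k ((t - u k) + (u k - y k)) * L k ((y k - s) + (u k - y k))"
      using k t(1) s(1) by (intro L_strict_product) auto
    then show ?thesis using \<open>u k < t\<close> \<open>s < y k\<close> k by (simp add: side_def max_def)
  qed
  have "M n u * M 0 y < Phi n y t * Phi 0 u s"
    unfolding t(2) s(2) Phi_mult
  proof (intro mult_strict_left_mono prod_less_prod)
    fix k assume k: "k \<in> {1..n}"
    have "L k (side n k u t) * L k (side 0 k y s) \<le> L k (side n k y t) * L k (side 0 k u s)"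
      using less[OF k] le[OF k] by (cases "y k = u k") (auto simp: side_def)
    then show "0 < L k (side n k u t) * L k (side 0 k y s) \<and>
      L k (side n k u t) * L k (side 0 k y s) \<le> L k (side n k y t) * L k (side 0 k u s)"
      using t(4)[OF k] s(4)[OF k] by simp
  qed (use i less t s in auto)
  also have "\<dots> \<le> M n y * M 0 u"
    by (intro mult_mono M_upper M_nonneg Phi_nonneg y u t(1) s(1))
  finally show ?thesis .
qed

text \<open>If \<open>x k > y k\<close>, the maximum \<open>u\<close> of both systems exceeds
  \<open>y\<close> in the \<open>k\<close>-th node, which pushes \<open>M n u / M 0 u\<close>
  strictly below \<open>\<alpha> n / \<alpha> 0\<close>; being a subsolution, \<open>u\<close> does
  not allow this. Exchanging the systems gives equality.\<close>

lemma equioscillation_le: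
  assumes \<alpha>: "\<And>j. j \<le> n \<Longrightarrow> \<alpha> j > 0"
    and x: "nodes x" "C > 0" "\<And>j. j \<le> n \<Longrightarrow> C * M j x = \<alpha> j"
    and y: "nodes y" "C' > 0" "\<And>j. j \<le> n \<Longrightarrow> C' * M j y = \<alpha> j"
    and k: "k \<in> {1..n}"
  shows "x k \<le> y k"
proof (rule ccontr)
  assume "\<not> x k \<le> y k"
  define u where "u k = max (x k) (y k)" for k
  have "subsolution \<alpha> x"
    unfolding subsolution_def using x(1) by (auto simp: x(3)[symmetric])
  moreover have "subsolution \<alpha> y"
    unfolding subsolution_def using y(1) by (auto simp: y(3)[symmetric])
  ultimately have sub: "subsolution \<alpha> u"
    unfolding u_def[abs_def] using \<alpha> by (intro subsolution_max)
  then have u: "nodes u" by (simp add: subsolution_def)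
  have chain: "\<alpha> n * M j u \<le> \<alpha> j * M n u" if "j \<le> n" for j
    using that
  proof (induction j rule: inc_induct)
    case (step j)
    have "\<alpha> (Suc j) * (\<alpha> n * M j u) = \<alpha> n * (\<alpha> (Suc j) * M j u)" by simp
    also have "\<dots> \<le> \<alpha> n * (\<alpha> j * M (Suc j) u)"
      using sub \<alpha>[of n] step by (auto simp: subsolution_def dest: bspec[of _ _ "Suc j"])
    also have "\<dots> = \<alpha> j * (\<alpha> n * M (Suc j) u)" by simp
    also have "\<dots> \<le> \<alpha> j * (\<alpha> (Suc j) * M n u)"
      using step \<alpha>[of j] by simp
    finally have "\<alpha> (Suc j) * (\<alpha> n * M j u) \<le> \<alpha> (Suc j) * (\<alpha> j * M n u)" by (simp add: mult_ac)
    then show ?case using \<alpha>[of "Suc j"] step by simp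
  qed simp
  \<comment> \<open>Some maximum is positive, and the chain of inequalities carries positivity to
    the last index.\<close>
  obtain j where j: "j \<le> n" "M j u > 0" using exists_M_pos[OF u] by auto
  have "0 < \<alpha> n * M j u" using j \<alpha> by simp
  then have "0 < \<alpha> j * M n u" using chain[OF j(1)] by simp
  then have "M n u > 0" using \<alpha>[OF j(1)] by (simp add: zero_less_mult_iff)
  have "M 0 y > 0" using y(2) y(3)[of 0] \<alpha>[of 0] zero_less_mult_pos[of C' "M 0 y"] by simp
  have "M n u * M 0 y < M n y * M 0 u"
    by (rule M_outer_cross_less[OF y(1) u _ k])
      (use \<open>\<not> x k \<le> y k\<close> \<open>M n u > 0\<close> \<open>M 0 y > 0\<close> in \<open>auto simp: u_def\<close>)
  then have "C' * (M n u * M 0 y) < C' * (M n y * M 0 u)" using y(2) by simp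
  then have "\<alpha> 0 * M n u < \<alpha> n * M 0 u" by (simp add: y(3)[symmetric] mult_ac)
  then show False using chain[of 0] by simp
qed

end

section \<open>Existence and uniqueness of the system and the constant\<close>

theorem theorem9p9:
  fixes n :: nat and L :: "nat \<Rightarrow> real \<Rightarrow> real" and w :: "real \<Rightarrow> real" and c :: real
  assumes L_cont: "\<And>j. j \<in> {1..n} \<Longrightarrow> continuous_on {0..1} (L j)"
    and L_nonneg: "\<And>j t. j \<in> {1..n} \<Longrightarrow> t \<in> {0..1} \<Longrightarrow> L j t \<ge> 0"
    and L_zero: "\<And>j. j \<in> {1..n} \<Longrightarrow> L j 0 = 0"
    and L_pos: "\<And>j t. j \<in> {1..n} \<Longrightarrow> t \<in> {0<..<1} \<Longrightarrow> L j t > 0"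
    and L_logconc: "\<And>j. j \<in> {1..n} \<Longrightarrow> concave_on {0<..<1} (\<lambda>t. ln (L j t))"
    and c_pos: "c > 0"
    and L_deriv: "\<And>j. j \<in> {1..n} \<Longrightarrow>
        AE t in lborel. t \<in> {0<..<1} \<longrightarrow>
          (\<exists>D. ((\<lambda>s. ln (L j s / L j (1 - s))) has_real_derivative D) (at t) \<and> D \<ge> c)"
    and w_usc: "usc_on {0..1} w"
    and w_nonneg: "\<And>t. t \<in> {0..1} \<Longrightarrow> w t \<ge> 0"
    and w_points: "\<exists>S. S \<subseteq> {t \<in> {0<..<1}. w t \<noteq> 0} \<and> finite S \<and> card S = n + 1"
  shows "\<forall>\<alpha> :: nat \<Rightarrow> real. (\<forall>j\<le>n. \<alpha> j > 0) \<longrightarrow>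
           (\<exists>y C. good_system n L w \<alpha> y C \<and>
              (\<forall>y' C'. good_system n L w \<alpha> y' C' \<longrightarrow>
                  C' = C \<and> (\<forall>k\<in>{1..n}. y' k = y k)))"
proof (intro allI impI)
  interpret log_concave_translates_deriv n L w c
    by unfold_locales (fact L_cont L_nonneg L_zero L_pos L_logconc w_usc w_nonneg w_points
        c_pos L_deriv)+
  fix \<alpha> :: "nat \<Rightarrow> real" assume "\<forall>j\<le>n. \<alpha> j > 0"
  then have \<alpha>: "\<And>j. j \<le> n \<Longrightarrow> \<alpha> j > 0" by simp
  obtain y C where y: "nodes y" "C > 0" "\<And>j. j \<le> n \<Longrightarrow> C * M j y = \<alpha> j"
    using equioscillation_exists[of \<alpha>, OF \<alpha>] by metis
  have "C' = C \<and> (\<forall>k\<in>{1..n}. y' k = y k)" if "good_system n L w \<alpha> y' C'" for y' C'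
  proof -
    have y': "nodes y'" "C' > 0" "\<And>j. j \<le> n \<Longrightarrow> C' * M j y' = \<alpha> j"
      using that good_system_iff[of \<alpha>, OF \<alpha>] by auto
    have eq: "y' k = y k" if "k \<in> {1..n}" for k
      using equioscillation_le[of \<alpha>, OF \<alpha> y y' that] equioscillation_le[of \<alpha>, OF \<alpha> y' y that]
      by simp
    \<comment> \<open>\<open>M\<close> reads a system only at the indices from 1 to
      \<open>n\<close>, where the two agree; the nonzero value \<open>M 0 y\<close> then determines
      the constant.\<close>
    then have "M 0 y' = M 0 y" unfolding M_def Phi_def side_def by simp
    then have "C' * M 0 y = C * M 0 y" using y(3)[of 0] y'(3)[of 0] by simp
    moreover have "M 0 y \<noteq> 0" using y(3)[of 0] \<alpha>[of 0] by auto
    ultimately show ?thesis using eq by simp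
  qed
  moreover have "good_system n L w \<alpha> y C"
    using y good_system_iff[of \<alpha>, OF \<alpha>] by simp
  ultimately show "\<exists>y C. good_system n L w \<alpha> y C \<and>
      (\<forall>y' C'. good_system n L w \<alpha> y' C' \<longrightarrow> C' = C \<and> (\<forall>k\<in>{1..n}. y' k = y k))"
    by blast
qed

end
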